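(* Let $X$ be a real Hilbert space, $\alpha>0$, $A:X\to X$ $\alpha$-cocoercive and $B:X\rightrightarrows X$ maximal monotone. Let $0<\underline\lambda\le\bar\lambda<2\alpha$, let $(\lambda_k)_{k\ge1}$ be a sequence in $[\underline\lambda,\bar\lambda]$, let $x_0\in X$, and let $(x_k)$ be generated by the Forward-Backward splitting method $$x_k=J_{\lambda_kB}\bigl(x_{k-1}-\lambda_kA(x_{k-1})\bigr),\qquad k=1,2,\dots$$ Define $\sigma=\sqrt{\bar\lambda/(2\alpha)}$. Then $0<\sigma<1$ and for any $x\in X$, $$J_{\lambda_kB}\circ(I-\lambda_kA)(x)\in J_{\lambda_k(A+B),\sigma}(x),\qquad k=1,2,\dots$$ In particular, $$x_k=J_{\lambda_kB}\circ(I-\lambda_kA)(x_{k-1})\in J_{\lambda_k(A+B),\sigma}(x_{k-1}),\qquad k=1,2,\dots,$$ and the sequence of maps $\bigl(J_{\lambda_kB}\circ(I-\lambda_kA)\bigr)_{k\ge1}$ satisfies properties P1 and P2 with respect to $(A+B)^{-1}(0)$.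
   Context: $A:X\to X$ is $\alpha$-cocoercive if $\langle x-y,Ax-Ay\rangle\ge\alpha\|Ax-Ay\|^2$ for all $x,y\in X$. $J_T=(I+T)^{-1}$ is the (single-valued, everywhere defined) resolvent of a maximal monotone operator $T$. For maximal monotone $T:X\rightrightarrows X$ (point-to-set) and $\varepsilon\ge 0$, $$T^{[\varepsilon]}(x)=\{v\in X : \langle x-y,v-u\rangle\ge-\varepsilon\ \text{ for all } y\in X,\ u\in T(y)\}.$$ For $\sigma\ge 0$, the $\sigma$-approximate resolvent of $T$ is the point-to-set map $$J_{T,\sigma}(x)=\{x-v : \exists\,\varepsilon\ge 0,\ y\in X \text{ with } v\in T^{[\varepsilon]}(y),\ \|v+y-x\|^2+2\varepsilon\le\sigma^2\|y-x\|^2\}.$$ Properties of a sequence $(F_n:X\rightrightarrows X)_{n\in\mathbb N}$ of point-to-set maps with respect to $\Omega\subset X$ (a single-valued map is identified with a singleton-valued point-to-set map): P1: if $\hat x\in F_n(x)$ (for some $n$ and $x\in X$) and $x^*\in\Omega$, then $\|x^*-\hat x\|\le\|x^*-x\|$. P2: if $(z_k)_{k\in\mathbb N}$ converges weakly to $\bar z$, $\hat z_k\in F_{n_k}(z_k)$ for all $k$ with $n_1<n_2<\cdots$, and for some $x^*\in\Omega$ one has $\lim_{k\to\infty}\left(\|x^*-z_k\|-\|x^*-\hat z_k\|\right)=0$, then $\bar z\in\Omega$. $(A+B)^{-1}(0)=\{x\in X : 0\in A(x)+B(x)\}$. *)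

theory Defs
  imports "HOL-Analysis.Analysis"
begin

text \<open>
  A real Hilbert space is a type of sort \<open>{real_inner, complete_space}\<close>. A point-to-set map
  from \<open>X\<close> to \<open>X\<close> is a function of type \<open>'a \<Rightarrow> 'a set\<close> (empty values are allowed).
\<close>

definition cocoercive :: "real \<Rightarrow> ('a::real_inner \<Rightarrow> 'a) \<Rightarrow> bool" where
  "cocoercive \<alpha> A \<longleftrightarrow> (\<forall>x y. inner (x - y) (A x - A y) \<ge> \<alpha> * (norm (A x - A y))\<^sup>2)"

definition monotone_op :: "('a::real_inner \<Rightarrow> 'a set) \<Rightarrow> bool" where
  "monotone_op T \<longleftrightarrow> (\<forall>x y. \<forall>u \<in> T x. \<forall>v \<in> T y. inner (x - y) (u - v) \<ge> 0)"

definition maximal_monotone :: "('a::real_inner \<Rightarrow> 'a set) \<Rightarrow> bool" where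
  "maximal_monotone T \<longleftrightarrow>
     monotone_op T \<and> (\<forall>S. monotone_op S \<and> (\<forall>x. T x \<subseteq> S x) \<longrightarrow> S = T)"

definition single_valued_op :: "('a \<Rightarrow> 'a) \<Rightarrow> 'a \<Rightarrow> 'a set" where
  "single_valued_op f = (\<lambda>x. {f x})"

definition op_add :: "('a::real_vector \<Rightarrow> 'a set) \<Rightarrow> ('a \<Rightarrow> 'a set) \<Rightarrow> 'a \<Rightarrow> 'a set" where
  "op_add S T = (\<lambda>x. {u + v | u v. u \<in> S x \<and> v \<in> T x})"

definition op_scale :: "real \<Rightarrow> ('a::real_vector \<Rightarrow> 'a set) \<Rightarrow> 'a \<Rightarrow> 'a set" where
  "op_scale c T = (\<lambda>x. {c *\<^sub>R v | v. v \<in> T x})"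

definition op_zeros :: "('a::real_vector \<Rightarrow> 'a set) \<Rightarrow> 'a set" where
  "op_zeros T = {x. 0 \<in> T x}"

text \<open>
  \<open>resolvent T x\<close> is the point \<open>(I + T)\<^sup>-\<^sup>1 x\<close>, i.e. the \<open>y\<close> with \<open>x \<in> y + T y\<close>. For a maximal
  monotone \<open>T\<close> on a Hilbert space this \<open>y\<close> exists for every \<open>x\<close> (Minty) and is unique; for
  other \<open>T\<close> the value may be unspecified.
\<close>

definition resolvent :: "('a::real_vector \<Rightarrow> 'a set) \<Rightarrow> 'a \<Rightarrow> 'a" where
  "resolvent T x = (THE y. x \<in> op_add (single_valued_op (\<lambda>z. z)) T y)"

definition enlargement :: "('a::real_inner \<Rightarrow> 'a set) \<Rightarrow> real \<Rightarrow> 'a \<Rightarrow> 'a set" where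
  "enlargement T \<epsilon> x = {v. \<forall>y. \<forall>u \<in> T y. inner (x - y) (v - u) \<ge> - \<epsilon>}"

definition approx_resolvent :: "('a::real_inner \<Rightarrow> 'a set) \<Rightarrow> real \<Rightarrow> 'a \<Rightarrow> 'a set" where
  "approx_resolvent T \<sigma> x =
     {x - v | v. \<exists>\<epsilon> y. \<epsilon> \<ge> 0 \<and> v \<in> enlargement T \<epsilon> y \<and>
        (norm (v + y - x))\<^sup>2 + 2 * \<epsilon> \<le> \<sigma>\<^sup>2 * (norm (y - x))\<^sup>2}"

text \<open>Weak convergence; by the Riesz theorem the functionals on a Hilbert space are the
  maps \<open>inner y\<close>.\<close>

definition weakly_converges :: "(nat \<Rightarrow> 'a::real_inner) \<Rightarrow> 'a \<Rightarrow> bool" where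
  "weakly_converges z l \<longleftrightarrow> (\<forall>y. (\<lambda>k. inner y (z k)) \<longlonglongrightarrow> inner y l)"

definition property_P1 :: "'a::real_inner set \<Rightarrow> (nat \<Rightarrow> 'a \<Rightarrow> 'a set) \<Rightarrow> bool" where
  "property_P1 \<Omega> F \<longleftrightarrow>
     (\<forall>n x x' xs. x' \<in> F n x \<and> xs \<in> \<Omega> \<longrightarrow> norm (xs - x') \<le> norm (xs - x))"

definition property_P2 :: "'a::real_inner set \<Rightarrow> (nat \<Rightarrow> 'a \<Rightarrow> 'a set) \<Rightarrow> bool" where
  "property_P2 \<Omega> F \<longleftrightarrow>
     (\<forall>z zbar z' n. weakly_converges z zbar \<and> strict_mono n \<and> (\<forall>k. z' k \<in> F (n k) (z k)) \<and>
        (\<exists>xs \<in> \<Omega>. (\<lambda>k. norm (xs - z k) - norm (xs - z' k)) \<longlonglongrightarrow> 0)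
        \<longrightarrow> zbar \<in> \<Omega>)"

text \<open>The map \<open>J\<^bsub>\<lambda>B\<^esub> \<circ> (I - \<lambda>A)\<close>.\<close>

definition forward_backward ::
    "('a::real_vector \<Rightarrow> 'a) \<Rightarrow> ('a \<Rightarrow> 'a set) \<Rightarrow> real \<Rightarrow> 'a \<Rightarrow> 'a" where
  "forward_backward A B c = resolvent (op_scale c B) \<circ> (\<lambda>x. x - c *\<^sub>R A x)"

end

theory Submission
  imports Defs
begin

text \<open>
  With \<open>y\<close> the forward-backward image of \<open>x\<close>, the vector \<open>v = x - y\<close> lies in
  \<open>\<lambda> (A x + B y)\<close>. Cocoercivity costs at most \<open>\<parallel>y - x\<parallel>\<^sup>2 / (4\<alpha>)\<close> when \<open>A\<close> is evaluated at \<open>x\<close>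
  instead of \<open>y\<close>, so \<open>v\<close> belongs to the enlargement of \<open>\<lambda> (A + B)\<close> at \<open>y\<close> with
  \<open>\<epsilon> = \<lambda> \<parallel>y - x\<parallel>\<^sup>2 / (4\<alpha>)\<close> and the error term \<open>v + y - x\<close> vanishes. P1 and P2 rest on a
  quantitative Fejer inequality that controls both \<open>A x - A x*\<close> and \<open>x - y\<close>.
\<close>

section \<open>Maximal monotone operators and their stability\<close>

lemma maximal_monotone_iff:
  "maximal_monotone T \<longleftrightarrow>
     monotone_op T \<and> (\<forall>x u. (\<forall>y. \<forall>v \<in> T y. inner (x - y) (u - v) \<ge> 0) \<longrightarrow> u \<in> T x)"
proof (intro iffI conjI allI impI)
  assume max: "maximal_monotone T"
  then show mono: "monotone_op T"
    by (simp add: maximal_monotone_def)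
  fix x u
  assume u: "\<forall>y. \<forall>v \<in> T y. inner (x - y) (u - v) \<ge> 0"
  have u': "inner (y - x) (v - u) \<ge> 0" if "v \<in> T y" for y v
  proof -
    have "inner (y - x) (v - u) = inner (x - y) (u - v)"
      by (simp add: inner_diff_left inner_diff_right)
    then show ?thesis
      using u that by simp
  qed
  \<comment> \<open>A point monotonically related to the whole graph can be added without losing
    monotonicity, so maximality forces it to be there already.\<close>
  have "monotone_op (T(x := insert u (T x)))"
    using mono u u' by (auto simp: monotone_op_def split: if_splits)
  moreover have "\<forall>y. T y \<subseteq> (T(x := insert u (T x))) y"
    by auto
  ultimately have "T(x := insert u (T x)) = T"
    using max by (simp add: maximal_monotone_def)
  then show "u \<in> T x"
    by (metis fun_upd_same insertI1)
next
  assume T: "monotone_op T \<and>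
    (\<forall>x u. (\<forall>y. \<forall>v \<in> T y. inner (x - y) (u - v) \<ge> 0) \<longrightarrow> u \<in> T x)"
  have "S = T" if S: "monotone_op S" and sub: "\<forall>x. T x \<subseteq> S x" for S
  proof (rule ext)
    fix x
    have "u \<in> T x" if "u \<in> S x" for u
      using T S sub that unfolding monotone_op_def by (metis subsetD)
    then show "S x = T x"
      using sub by blast
  qed
  then show "maximal_monotone T"
    using T by (simp add: maximal_monotone_def)
qed

lemma maximal_monotoneD:
  assumes "maximal_monotone T" "v \<in> T y" "v' \<in> T y'"
  shows "inner (y - y') (v - v') \<ge> 0"
  using assms by (simp add: maximal_monotone_def monotone_op_def)

lemma maximal_monotone_op_scale:
  assumes T: "maximal_monotone T" and c: "c > 0"
  shows "maximal_monotone (op_scale c T)"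
  unfolding maximal_monotone_iff
proof (intro conjI allI impI)
  show "monotone_op (op_scale c T)"
    using c maximal_monotoneD[OF T]
    by (auto simp: monotone_op_def op_scale_def simp flip: scaleR_diff_right)
next
  fix x u
  assume u: "\<forall>y. \<forall>v \<in> op_scale c T y. inner (x - y) (u - v) \<ge> 0"
  have "inner (x - y) (u /\<^sub>R c - v) \<ge> 0" if "v \<in> T y" for y v
  proof -
    have "inner (x - y) (u - c *\<^sub>R v) \<ge> 0"
      using u that by (auto simp: op_scale_def)
    moreover have "u - c *\<^sub>R v = c *\<^sub>R (u /\<^sub>R c - v)"
      using c by (simp add: scaleR_diff_right)
    ultimately show ?thesis
      using c by (simp add: zero_le_mult_iff)
  qed
  then have "u /\<^sub>R c \<in> T x"
    using T by (simp add: maximal_monotone_iff)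
  then show "u \<in> op_scale c T x"
    using c by (auto simp: op_scale_def intro!: exI[of _ "u /\<^sub>R c"])
qed

text \<open>Reduces solving \<open>w - y \<in> T y\<close> to the case \<open>w = 0\<close>.\<close>

lemma maximal_monotone_translate:
  assumes T: "maximal_monotone T"
  shows "maximal_monotone (\<lambda>x. {u. u + w \<in> T x})"
  unfolding maximal_monotone_iff
proof (intro conjI allI impI)
  show "monotone_op (\<lambda>x. {u. u + w \<in> T x})"
    using maximal_monotoneD[OF T] by (fastforce simp: monotone_op_def)
next
  fix x u
  assume u: "\<forall>y. \<forall>v \<in> {u. u + w \<in> T y}. inner (x - y) (u - v) \<ge> 0"
  have "inner (x - y) (u + w - v) \<ge> 0" if "v \<in> T y" for y v
    using u[rule_format, of "v - w" y] that by (simp add: algebra_simps)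
  then show "u \<in> {u. u + w \<in> T x}"
    using T by (simp add: maximal_monotone_iff)
qed

section \<open>Minty's theorem by strongly convex minimization\<close>

lemma norm_sq_convex_comb:
  fixes p q :: "'a::real_inner"
  shows "(norm ((1 - s) *\<^sub>R p + s *\<^sub>R q))\<^sup>2 =
    (1 - s) * (norm p)\<^sup>2 + s * (norm q)\<^sup>2 - s * (1 - s) * (norm (q - p))\<^sup>2"
  by (simp add: power2_norm_eq_inner inner_add_left inner_add_right inner_diff_left
      inner_diff_right inner_commute algebra_simps)

text \<open>Strong convexity makes the first components of a minimizing sequence Cauchy, which
  replaces compactness. The extra square in the conclusion comes from comparing the minimizer with
  points on the segment towards \<open>(p, t)\<close>.\<close>

lemma strongly_convex_minimizer:
  fixes C :: "('h::{real_inner, complete_space} \<times> real) set"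
  assumes C: "closed C" "convex C" "C \<noteq> {}"
    and lower: "\<And>p t. (p, t) \<in> C \<Longrightarrow> m \<le> t + (norm p)\<^sup>2 / 2"
  shows "\<exists>p0 t0. (p0, t0) \<in> C \<and> (\<forall>p t. (p, t) \<in> C \<longrightarrow>
    t0 + (norm p0)\<^sup>2 / 2 + (norm (p - p0))\<^sup>2 / 2 \<le> t + (norm p)\<^sup>2 / 2)"
proof -
  define f where "f q = snd q + (norm (fst q))\<^sup>2 / 2" for q :: "'h \<times> real"
  define \<mu> where "\<mu> = Inf (f ` C)"
  have bdd: "bdd_below (f ` C)"
    using lower by (force simp: f_def intro!: bdd_belowI2[of _ m])
  have \<mu>_le: "\<mu> \<le> f q" if "q \<in> C" for q
    unfolding \<mu>_def using bdd that by (rule cINF_lower)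
  have f_comb: "f ((1 - s) *\<^sub>R q + s *\<^sub>R r) =
      (1 - s) * f q + s * f r - s * (1 - s) * (norm (fst r - fst q))\<^sup>2 / 2" for s q r
    by (simp add: f_def norm_sq_convex_comb) (simp add: field_simps)
  have in_C: "(1 - s) *\<^sub>R q + s *\<^sub>R r \<in> C" if "q \<in> C" "r \<in> C" "0 \<le> s" "s \<le> 1" for s q r
    using C(2) that by (simp add: convex_alt)
  have "\<exists>q \<in> C. f q < \<mu> + inverse (real (Suc n))" for n
    using cINF_less_iff[OF C(3) bdd, of "\<mu> + inverse (real (Suc n))"]
    unfolding \<mu>_def by simp
  then obtain q where q: "q n \<in> C" "f (q n) < \<mu> + inverse (real (Suc n))" for n
    by metis
  have f_lim: "(\<lambda>n. f (q n)) \<longlonglongrightarrow> \<mu>"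
  proof (rule real_tendsto_sandwich[OF _ _ tendsto_const LIMSEQ_inverse_real_of_nat_add])
    show "eventually (\<lambda>n. \<mu> \<le> f (q n)) sequentially"
      using q(1) \<mu>_le by simp
    show "eventually (\<lambda>n. f (q n) \<le> \<mu> + inverse (real (Suc n))) sequentially"
      using q(2) by (intro always_eventually allI less_imp_le)
  qed
  \<comment> \<open>At the midpoint of \<open>q i\<close> and \<open>q j\<close> the value of
    \<open>f\<close> is still at least \<mu>, which bounds the strong convexity term.\<close>
  have close: "(norm (fst (q i) - fst (q j)))\<^sup>2 \<le> 4 * (f (q i) + f (q j) - 2 * \<mu>)" for i j
    using f_comb[of "1/2" "q j" "q i"] \<mu>_le[OF in_C[OF q(1) q(1), of "1/2" j i]]
    by simp
  have "Cauchy (\<lambda>n. fst (q n))"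
  proof (rule metric_CauchyI)
    fix e :: real assume e: "e > 0"
    then have "eventually (\<lambda>n. f (q n) < \<mu> + e\<^sup>2 / 8) sequentially"
      using f_lim by (intro order_tendstoD(2)) auto
    then obtain N where N: "f (q n) < \<mu> + e\<^sup>2 / 8" if "n \<ge> N" for n
      by (auto simp: eventually_sequentially)
    have "dist (fst (q i)) (fst (q j)) < e" if "i \<ge> N" "j \<ge> N" for i j
    proof -
      have "(norm (fst (q i) - fst (q j)))\<^sup>2 < e\<^sup>2"
        by (rule le_less_trans[OF close]) (use N[OF that(1)] N[OF that(2)] in argo)
      then show ?thesis
        using e by (simp add: dist_norm power2_less_imp_less)
    qed
    then show "\<exists>N. \<forall>i\<ge>N. \<forall>j\<ge>N. dist (fst (q i)) (fst (q j)) < e"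
      by blast
  qed
  then obtain p0 where p0: "(\<lambda>n. fst (q n)) \<longlonglongrightarrow> p0"
    by (auto simp: Cauchy_convergent_iff convergent_def)
  \<comment> \<open>The value forced by \<open>f (p0, t0) = \<mu>\<close>; convergence of
    \<open>f (q n)\<close> and of the first components makes the second components tend to
    it.\<close>
  define t0 where "t0 = \<mu> - (norm p0)\<^sup>2 / 2"
  have "(\<lambda>n. f (q n) - (norm (fst (q n)))\<^sup>2 / 2) \<longlonglongrightarrow> t0"
    unfolding t0_def by (intro tendsto_intros f_lim p0) auto
  then have "(\<lambda>n. snd (q n)) \<longlonglongrightarrow> t0"
    by (simp add: f_def)
  then have "(\<lambda>n. (fst (q n), snd (q n))) \<longlonglongrightarrow> (p0, t0)"
    by (intro tendsto_Pair p0)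
  then have mem: "(p0, t0) \<in> C"
    using closed_sequentially[OF C(1), of "\<lambda>n. (fst (q n), snd (q n))"] q(1) by simp
  have f0: "f (p0, t0) = \<mu>"
    by (simp add: f_def t0_def)
  have "\<mu> + (norm (p - p0))\<^sup>2 / 2 \<le> f (p, t)" if "(p, t) \<in> C" for p t
  proof -
    let ?D = "(norm (p - p0))\<^sup>2 / 2"
    \<comment> \<open>Minimality along the segment, divided by \<open>s\<close>; the limit
      \<open>s\<close> to 0 then removes the factor \<open>1 - s\<close>.\<close>
    have "(1 - s) * ?D \<le> f (p, t) - \<mu>" if "0 < s" "s < 1" for s
    proof -
      have "\<mu> \<le> (1 - s) * \<mu> + s * f (p, t) - s * (1 - s) * ?D"
        using \<mu>_le[OF in_C[OF mem \<open>(p, t) \<in> C\<close>, of s]] f_comb[of s "(p0, t0)" "(p, t)"] f0 that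
        by simp
      then have "s * ((1 - s) * ?D) \<le> s * (f (p, t) - \<mu>)"
        by (simp add: algebra_simps)
      then show ?thesis
        using that by (simp only: mult_le_cancel_left_pos)
    qed
    then have "eventually (\<lambda>s. (1 - s) * ?D \<le> f (p, t) - \<mu>) (at_right 0)"
      by (auto simp: eventually_at_right_field intro!: exI[of _ 1])
    moreover have "((\<lambda>s. (1 - s) * ?D) \<longlongrightarrow> (1 - 0) * ?D) (at_right 0)"
      by (intro tendsto_intros)
    ultimately have "(1 - 0) * ?D \<le> f (p, t) - \<mu>"
      by (intro tendsto_upperbound) auto
    then show ?thesis
      by simp
  qed
  then have "\<forall>p t. (p, t) \<in> C \<longrightarrow>
      t0 + (norm p0)\<^sup>2 / 2 + (norm (p - p0))\<^sup>2 / 2 \<le> t + (norm p)\<^sup>2 / 2"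
    using f0 by (simp add: f_def)
  then show ?thesis
    using mem by blast
qed

text \<open>
  \<open>C\<close> is the epigraph of the Fitzpatrick function of \<open>T\<close>, which dominates the duality pairing.
  Adding \<open>\<parallel>(x, u)\<parallel>\<^sup>2 / 2\<close> makes it strongly convex, and the optimality inequality at the minimizer
  \<open>(x0, u0)\<close> says that \<open>(- u0, - x0)\<close> is monotonically related to \<open>T\<close>.
\<close>

theorem Minty_zero:
  fixes T :: "'a::{real_inner, complete_space} \<Rightarrow> 'a set"
  assumes T: "maximal_monotone T"
  shows "\<exists>y. - y \<in> T y"
proof -
  define G where "G = {(y, v). v \<in> T y}"
  \<comment> \<open>An intersection of half-spaces indexed by the graph, so closedness and convexity
    are immediate.\<close>
  define C :: "(('a \<times> 'a) \<times> real) set"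
    where "C = (\<Inter>(y, v) \<in> G. {q. inner ((v, y), - 1) q \<le> inner y v})"
  have C_iff: "((x, u), t) \<in> C \<longleftrightarrow> (\<forall>y. \<forall>v \<in> T y. inner x v + inner y u - inner y v \<le> t)" for x u t
    by (auto simp: C_def G_def inner_commute algebra_simps)
  have C_graph: "((y, v), inner y v) \<in> C" if "v \<in> T y" for y v
    unfolding C_iff
  proof (intro allI ballI)
    fix y' v' assume "v' \<in> T y'"
    from maximal_monotoneD[OF T that this]
    show "inner y v' + inner y' v - inner y' v' \<le> inner y v"
      by (simp add: inner_diff_left inner_diff_right)
  qed
  \<comment> \<open>If \<open>u \<in> T x\<close>, test with this pair itself. Otherwise maximality
    yields a graph point with negative product, whose half-space bound exceeds
    \<open>inner x u\<close>.\<close>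
  have C_ge: "inner x u \<le> t" if "((x, u), t) \<in> C" for x u t
  proof (cases "u \<in> T x")
    case True
    then have "inner x u + inner x u - inner x u \<le> t"
      using that unfolding C_iff by blast
    then show ?thesis
      by simp
  next
    case False
    then obtain y v where yv: "v \<in> T y" "inner (x - y) (u - v) < 0"
      using T unfolding maximal_monotone_iff by (meson not_le)
    then have "inner x v + inner y u - inner y v \<le> t"
      using that by (simp add: C_iff)
    then show ?thesis
      using yv(2) by (simp add: inner_diff_left inner_diff_right)
  qed
  have lower: "(norm (x + u))\<^sup>2 / 2 \<le> t + (norm (x, u))\<^sup>2 / 2" if "((x, u), t) \<in> C" for x u t
    using C_ge[OF that]
    by (simp add: power2_norm_eq_inner inner_add_left inner_add_right inner_commute field_simps)
  \<comment> \<open>Every point is vacuously related to an empty graph, so maximality would put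
    \<open>0\<close> into \<open>T 0\<close>.\<close>
  have "\<exists>y v. v \<in> T y"
  proof (rule ccontr)
    assume "\<nexists>y v. v \<in> T y"
    then have "0 \<in> T 0"
      using T by (simp add: maximal_monotone_iff)
    then show False
      using \<open>\<nexists>y v. v \<in> T y\<close> by blast
  qed
  then have ne: "C \<noteq> {}"
    using C_graph by blast
  have cl: "closed C" "convex C"
    unfolding C_def
    by (auto intro!: closed_INT convex_INT closed_Collect_le continuous_intros convex_halfspace_le)
  have nonneg: "0 \<le> t + (norm p)\<^sup>2 / 2" if "(p, t) \<in> C" for p t
  proof -
    have "0 \<le> (norm (fst p + snd p))\<^sup>2 / 2"
      by simp
    also have "\<dots> \<le> t + (norm p)\<^sup>2 / 2"
      using lower[of "fst p" "snd p" t] that by simp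
    finally show ?thesis .
  qed
  obtain p0 t0 where mem: "(p0, t0) \<in> C"
    and opt: "\<And>p t. (p, t) \<in> C \<Longrightarrow>
      t0 + (norm p0)\<^sup>2 / 2 + (norm (p - p0))\<^sup>2 / 2 \<le> t + (norm p)\<^sup>2 / 2"
    using strongly_convex_minimizer[OF cl ne nonneg] by blast
  obtain x0 u0 where p0: "p0 = (x0, u0)"
    by fastforce
  define \<mu> where "\<mu> = t0 + (norm p0)\<^sup>2 / 2"
  have \<mu>: "\<mu> \<ge> 0"
    unfolding \<mu>_def using nonneg[OF mem] .
  \<comment> \<open>In the optimality inequality at the graph point \<open>(y, v)\<close> the
    squares of \<open>y\<close> and \<open>v\<close> cancel; adding \<open>inner x0 u0\<close>
    completes both the product and the square.\<close>
  have key: "(norm (x0 + u0))\<^sup>2 / 2 + \<mu> \<le> inner (- u0 - y) (- x0 - v)" if "v \<in> T y" for y v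
    using opt[OF C_graph[OF that]] unfolding p0 \<mu>_def
    by (simp add: power2_norm_eq_inner inner_add_left inner_add_right inner_diff_left
        inner_diff_right inner_commute field_simps)
  have "inner (- u0 - y) (- x0 - v) \<ge> 0" if "v \<in> T y" for y v
    by (rule order_trans[OF _ key[OF that]]) (use \<mu> in simp)
  then have mem': "- x0 \<in> T (- u0)"
    using T by (simp add: maximal_monotone_iff)
  \<comment> \<open>The pair \<open>(- u0, - x0)\<close> is now itself a graph point, and at it the
    right side of \<open>key\<close> vanishes.\<close>
  then have "(norm (x0 + u0))\<^sup>2 / 2 + \<mu> \<le> 0"
    using key[OF mem'] by simp
  then have "(norm (x0 + u0))\<^sup>2 \<le> 0"
    using \<mu> by linarith
  then have "x0 = - u0"
    by (simp add: eq_neg_iff_add_eq_0)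
  then show ?thesis
    using mem' by (intro exI[of _ "- u0"]) simp
qed

corollary Minty_surjective:
  fixes T :: "'a::{real_inner, complete_space} \<Rightarrow> 'a set"
  assumes "maximal_monotone T"
  shows "\<exists>y. w - y \<in> T y"
  using Minty_zero[OF maximal_monotone_translate[OF assms, of w]] by auto

text \<open>Minty gives existence and monotonicity gives uniqueness, so the \<open>THE\<close> in
  \<open>resolvent\<close> denotes the intended point.\<close>

lemma resolvent_mem:
  fixes T :: "'a::{real_inner, complete_space} \<Rightarrow> 'a set"
  assumes T: "maximal_monotone T"
  shows "w - resolvent T w \<in> T (resolvent T w)"
proof -
  have iff: "w \<in> op_add (single_valued_op (\<lambda>z. z)) T y \<longleftrightarrow> w - y \<in> T y" for y
    by (force simp: op_add_def single_valued_op_def)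
  have "y = y'" if "w - y \<in> T y" "w - y' \<in> T y'" for y y'
  proof -
    have "0 \<le> inner (y - y') (w - y - (w - y'))"
      by (rule maximal_monotoneD[OF T that])
    also have "\<dots> = - (norm (y - y'))\<^sup>2"
      by (simp add: power2_norm_eq_inner inner_diff_left inner_diff_right inner_commute)
    finally show ?thesis
      by simp
  qed
  then have "\<exists>!y. w - y \<in> T y"
    using Minty_surjective[OF T, of w] by blast
  then show ?thesis
    unfolding resolvent_def iff by (rule theI')
qed

section \<open>The forward-backward step: approximate resolvent and Fejer inequality\<close>

lemma forward_backward_mem:
  fixes B :: "'a::{real_inner, complete_space} \<Rightarrow> 'a set"
  assumes B: "maximal_monotone B" and c: "c > 0"
  shows "(z - forward_backward A B c z) /\<^sub>R c - A z \<in> B (forward_backward A B c z)"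
proof -
  let ?y = "forward_backward A B c z"
  have "z - c *\<^sub>R A z - ?y \<in> op_scale c B ?y"
    using resolvent_mem[OF maximal_monotone_op_scale[OF B c], of "z - c *\<^sub>R A z"]
    by (simp add: forward_backward_def)
  then obtain b where b: "b \<in> B ?y" "z - c *\<^sub>R A z - ?y = c *\<^sub>R b"
    by (auto simp: op_scale_def)
  then have "z - ?y = c *\<^sub>R (b + A z)"
    by (simp add: algebra_simps)
  then have "(z - ?y) /\<^sub>R c - A z = b"
    using c by simp
  then show ?thesis
    using b(1) by simp
qed

lemma op_zeros_iff: "x \<in> op_zeros (op_add (single_valued_op A) B) \<longleftrightarrow> - A x \<in> B x"
proof
  assume "x \<in> op_zeros (op_add (single_valued_op A) B)"
  then obtain v where "v \<in> B x" "0 = A x + v"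
    by (auto simp: op_zeros_def op_add_def single_valued_op_def)
  moreover from this(2) have "- A x = v"
    by (simp add: eq_neg_iff_add_eq_0 add.commute neg_eq_iff_add_eq_0)
  ultimately show "- A x \<in> B x"
    by simp
next
  assume "- A x \<in> B x"
  then show "x \<in> op_zeros (op_add (single_valued_op A) B)"
    by (force simp: op_zeros_def op_add_def single_valued_op_def)
qed

text \<open>Young's inequality bounds \<open>inner (y - x) (A x - A w)\<close> below; its weight is
  tuned so that the loss in \<open>A x - A w\<close> is exactly what cocoercivity between
  \<open>x\<close> and \<open>w\<close> supplies. The point \<open>w\<close> is arbitrary because
  the enlargement tests against the whole graph.\<close>

lemma cocoercive_three_point:
  assumes A: "cocoercive \<alpha> A" and \<alpha>: "\<alpha> > 0"
  shows "- ((norm (y - x))\<^sup>2 / (4 * \<alpha>)) \<le> inner (y - w) (A x - A w)"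
proof -
  let ?g = "A x - A w"
  have "0 \<le> (norm ((y - x) + (2 * \<alpha>) *\<^sub>R ?g))\<^sup>2 / (4 * \<alpha>)"
    using \<alpha> by simp
  also have "\<dots> = (norm (y - x))\<^sup>2 / (4 * \<alpha>) + inner (y - x) ?g + \<alpha> * (norm ?g)\<^sup>2"
    unfolding power2_norm_eq_inner inner_add_left inner_add_right inner_scaleR_left
      inner_scaleR_right inner_commute[of ?g "y - x"]
    using \<alpha> by (simp add: field_simps)
  also have "\<dots> \<le> (norm (y - x))\<^sup>2 / (4 * \<alpha>) + inner (y - x) ?g + inner (x - w) ?g"
    using A by (simp add: cocoercive_def)
  also have "\<dots> = (norm (y - x))\<^sup>2 / (4 * \<alpha>) + inner (y - w) ?g"
    by (simp add: inner_diff_left)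
  finally show ?thesis
    by simp
qed

lemma forward_backward_approx_resolvent:
  fixes A :: "'a::{real_inner, complete_space} \<Rightarrow> 'a"
  assumes A: "cocoercive \<alpha> A" and \<alpha>: "\<alpha> > 0" and B: "maximal_monotone B"
    and c: "c > 0" "c / (2 * \<alpha>) \<le> \<sigma>\<^sup>2"
  shows "forward_backward A B c x
    \<in> approx_resolvent (op_scale c (op_add (single_valued_op A) B)) \<sigma> x"
proof -
  define y where "y = forward_backward A B c x"
  define b where "b = (x - y) /\<^sub>R c - A x"
  define \<epsilon> where "\<epsilon> = c * ((norm (y - x))\<^sup>2 / (4 * \<alpha>))"
  have b: "b \<in> B y"
    unfolding b_def y_def by (rule forward_backward_mem[OF B c(1)])
  have xy: "x - y = c *\<^sub>R (A x + b)"
    using c(1) by (simp add: b_def)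
  have "x - y \<in> enlargement (op_scale c (op_add (single_valued_op A) B)) \<epsilon> y"
    unfolding enlargement_def
  proof (intro CollectI allI ballI)
    fix w u
    assume "u \<in> op_scale c (op_add (single_valued_op A) B) w"
    then obtain b' where b': "b' \<in> B w" "u = c *\<^sub>R (A w + b')"
      by (auto simp: op_scale_def op_add_def single_valued_op_def)
    have "- ((norm (y - x))\<^sup>2 / (4 * \<alpha>)) \<le> inner (y - w) (A x - A w) + inner (y - w) (b - b')"
      using cocoercive_three_point[OF A \<alpha>, of y x w] maximal_monotoneD[OF B b b'(1)] by linarith
    then have "c * - ((norm (y - x))\<^sup>2 / (4 * \<alpha>))
        \<le> c * (inner (y - w) (A x - A w) + inner (y - w) (b - b'))"
      using c(1) by (intro mult_left_mono) auto
    also have "\<dots> = inner (y - w) (x - y - u)"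
      unfolding xy b'(2) by (simp add: inner_diff_right inner_add_right algebra_simps)
    finally show "- \<epsilon> \<le> inner (y - w) (x - y - u)"
      by (simp add: \<epsilon>_def)
  qed
  moreover have "\<epsilon> \<ge> 0"
    using c(1) \<alpha> by (simp add: \<epsilon>_def)
  \<comment> \<open>The residual is zero, and \<open>2 * \<epsilon>\<close> is
    \<open>c / (2 * \<alpha>)\<close> times the squared distance.\<close>
  moreover have "(norm (x - y + y - x))\<^sup>2 + 2 * \<epsilon> \<le> \<sigma>\<^sup>2 * (norm (y - x))\<^sup>2"
    using mult_right_mono[OF c(2), of "(norm (y - x))\<^sup>2"] by (simp add: \<epsilon>_def)
  ultimately have "x - (x - y) \<in> approx_resolvent (op_scale c (op_add (single_valued_op A) B)) \<sigma> x"
    unfolding approx_resolvent_def by blast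
  then show ?thesis
    by (simp add: y_def)
qed

text \<open>Combines monotonicity of \<open>B\<close> between \<open>y\<close> and \<open>xs\<close>
  with cocoercivity of \<open>A\<close> between \<open>z\<close> and \<open>xs\<close>. Both defects
  are kept on the left: P1 uses their sign, P2 that they tend to zero.\<close>

lemma forward_backward_Fejer:
  fixes A :: "'a::{real_inner, complete_space} \<Rightarrow> 'a" and z :: 'a
  assumes A: "cocoercive \<alpha> A" and B: "maximal_monotone B" and c: "c > 0" and xs: "- A xs \<in> B xs"
  defines "y \<equiv> forward_backward A B c z"
  shows "c * (2 * \<alpha> - c) * (norm (A z - A xs))\<^sup>2 + (norm (z - y - c *\<^sub>R (A z - A xs)))\<^sup>2
    \<le> (norm (xs - z))\<^sup>2 - (norm (xs - y))\<^sup>2"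
proof -
  define e d g where "e = z - xs" and "d = z - y" and "g = A z - A xs"
  have "0 \<le> inner (y - xs) ((z - y) /\<^sub>R c - A z - (- A xs))"
    using forward_backward_mem[OF B c] xs unfolding y_def by (intro maximal_monotoneD[OF B])
  moreover have "y - xs = e - d" "(z - y) /\<^sub>R c - A z - (- A xs) = d /\<^sub>R c - g"
    by (simp_all add: e_def d_def g_def)
  ultimately have "0 \<le> c * inner (e - d) (d /\<^sub>R c - g)"
    using c by simp
  also have "\<dots> = inner (e - d) d - c * inner (e - d) g"
    using c by (simp add: inner_diff_right right_diff_distrib)
  finally have 1: "c * inner (e - d) g \<le> inner (e - d) d"
    by simp
  have "\<alpha> * (norm g)\<^sup>2 \<le> inner e g"
    using A by (simp add: cocoercive_def e_def g_def)
  then have 2: "c * (\<alpha> * (norm g)\<^sup>2) \<le> c * inner e g"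
    using c by simp
  \<comment> \<open>After expansion the terms quadratic in \<open>c\<close> cancel, leaving twice
    the sum of \<open>1\<close> and \<open>2\<close>.\<close>
  have "c * (2 * \<alpha> - c) * (norm g)\<^sup>2 + (norm (d - c *\<^sub>R g))\<^sup>2 \<le> (norm e)\<^sup>2 - (norm (e - d))\<^sup>2"
    using 1 2
    by (simp add: power2_norm_eq_inner inner_diff_left inner_diff_right inner_commute algebra_simps)
  moreover have "norm (xs - z) = norm e" "norm (xs - y) = norm (e - d)"
    by (simp_all add: e_def d_def norm_minus_commute)
  ultimately show ?thesis
    by (simp add: d_def g_def)
qed

section \<open>Weak convergence\<close>

text \<open>Uniform boundedness via Baire: the closed sets \<open>E n\<close> cover the space, so
  one of them contains a ball, which bounds the sequence in all directions at once.\<close>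

lemma weakly_converges_imp_Bseq:
  fixes z :: "nat \<Rightarrow> 'a::{real_inner, complete_space}"
  assumes z: "weakly_converges z l"
  shows "Bseq z"
proof -
  define E where "E n = {y. \<forall>k. \<bar>inner y (z k)\<bar> \<le> real n}" for n
  have closed_E: "closed (E n)" for n
    unfolding E_def by (intro closed_Collect_all closed_Collect_le continuous_intros)
  have "(\<Union>n. E n) = UNIV"
  proof -
    have "\<exists>n. y \<in> E n" for y
    proof -
      have "Bseq (\<lambda>k. inner y (z k))"
        using z unfolding weakly_converges_def by (blast intro: convergent_imp_Bseq convergentI)
      then obtain K where "\<And>k. \<bar>inner y (z k)\<bar> \<le> K"
        by (auto simp: Bseq_def)
      moreover obtain n where "K \<le> real n"
        using real_arch_simple by blast
      ultimately show ?thesis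
        unfolding E_def by (auto intro!: exI[of _ n] intro: order_trans)
    qed
    then show ?thesis
      by blast
  qed
  then have "euclidean interior_of (\<Union>(range E)) \<noteq> {}"
    by simp
  then have "\<exists>n. interior (E n) \<noteq> {}"
    using Baire_category_alt[of "euclidean :: 'a topology" "range E"] closed_E
      completely_metrizable_space_euclidean
    by (auto simp: euclidean_interior_of)
  then obtain n y0 where "y0 \<in> interior (E n)"
    by blast
  then obtain r where r: "r > 0" "cball y0 r \<subseteq> E n"
    by (auto simp: mem_interior_cball)
  have "norm (z k) \<le> 2 * real n / r" for k
  proof (cases "z k = 0")
    case False
    \<comment> \<open>A vector along \<open>z k\<close> whose length is the radius; subtracting the
      bounds at \<open>y0 + h\<close> and \<open>y0\<close> isolates
      \<open>r * norm (z k)\<close>.\<close>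
    define h where "h = (r / norm (z k)) *\<^sub>R z k"
    have "norm h = r"
      using False r(1) by (simp add: h_def)
    then have "y0 \<in> E n" "y0 + h \<in> E n"
      using r by (auto intro!: subsetD[OF r(2)] simp: dist_norm)
    then have "\<bar>inner y0 (z k)\<bar> \<le> real n" "\<bar>inner (y0 + h) (z k)\<bar> \<le> real n"
      by (auto simp: E_def)
    then have "inner h (z k) \<le> 2 * real n"
      by (simp add: inner_add_left)
    moreover have "inner h (z k) = r * norm (z k)"
      using False by (simp add: h_def power2_norm_eq_inner[symmetric] power2_eq_square)
    ultimately show ?thesis
      using r(1) by (simp add: field_simps)
  qed (use r in simp)
  then show ?thesis
    by (rule BseqI')
qed

lemma weakly_converges_add_null:
  assumes "weakly_converges z l" "(\<lambda>k. z k - z' k) \<longlonglongrightarrow> 0"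
  shows "weakly_converges z' l"
  unfolding weakly_converges_def
proof
  fix y
  have "(\<lambda>k. inner y (z k)) \<longlonglongrightarrow> inner y l"
    using assms(1) by (simp add: weakly_converges_def)
  then have "(\<lambda>k. inner y (z k) - inner y (z k - z' k)) \<longlonglongrightarrow> inner y l - inner y 0"
    by (rule tendsto_diff[OF _ tendsto_inner[OF tendsto_const assms(2)]])
  then show "(\<lambda>k. inner y (z' k)) \<longlonglongrightarrow> inner y l"
    by (simp add: inner_diff_right)
qed

text \<open>The product of the weak and the strong sequence converges because \<open>z\<close> is
  bounded, so \<open>inner (z k) (w k - w')\<close> vanishes. This lets monotonicity and
  cocoercivity pass to weak limits.\<close>

lemma weakly_converges_inner:
  fixes z :: "nat \<Rightarrow> 'a::{real_inner, complete_space}"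
  assumes z: "weakly_converges z l" and w: "w \<longlonglongrightarrow> w'"
  shows "(\<lambda>k. inner (z k - y) (w k - v)) \<longlonglongrightarrow> inner (l - y) (w' - v)"
proof -
  have "(\<lambda>k. w k - w') \<longlonglongrightarrow> 0"
    using w by (simp add: LIM_zero)
  then have "Zfun (\<lambda>k. w k - w') sequentially"
    by (simp add: tendsto_Zfun_iff)
  moreover have "Bfun z sequentially"
    using weakly_converges_imp_Bseq[OF z] .
  ultimately have "Zfun (\<lambda>k. inner (z k) (w k - w')) sequentially"
    by (intro bounded_bilinear.Bfun_prod_Zfun[OF bounded_bilinear_inner])
  then have "(\<lambda>k. inner (z k) (w k - w')) \<longlonglongrightarrow> 0"
    by (simp add: tendsto_Zfun_iff)
  moreover have "(\<lambda>k. inner (z k) (w' - v)) \<longlonglongrightarrow> inner l (w' - v)"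
    using z by (simp add: weakly_converges_def inner_commute[of _ "w' - v"])
  moreover have "(\<lambda>k. inner y (w k - v)) \<longlonglongrightarrow> inner y (w' - v)"
    by (intro tendsto_intros w)
  ultimately have "(\<lambda>k. inner (z k) (w k - w') + inner (z k) (w' - v) - inner y (w k - v))
      \<longlonglongrightarrow> 0 + inner l (w' - v) - inner y (w' - v)"
    by (intro tendsto_diff tendsto_add)
  then show ?thesis
    by (simp add: inner_diff_left inner_diff_right algebra_simps)
qed

section \<open>Properties P1 and P2\<close>

lemma forward_backward_P1:
  fixes A :: "'a::{real_inner, complete_space} \<Rightarrow> 'a"
  assumes A: "cocoercive \<alpha> A" and B: "maximal_monotone B"
    and c: "\<And>n. 0 < c n" "\<And>n. c n \<le> 2 * \<alpha>"
  shows "property_P1 (op_zeros (op_add (single_valued_op A) B))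
    (\<lambda>n. single_valued_op (forward_backward A B (c n)))"
  unfolding property_P1_def
proof (intro allI impI)
  fix n x x' xs
  assume *: "x' \<in> single_valued_op (forward_backward A B (c n)) x \<and>
    xs \<in> op_zeros (op_add (single_valued_op A) B)"
  then have x': "x' = forward_backward A B (c n) x" and xs: "- A xs \<in> B xs"
    unfolding op_zeros_iff by (simp_all add: single_valued_op_def)
  have "0 \<le> c n * (2 * \<alpha> - c n) * (norm (A x - A xs))\<^sup>2
      + (norm (x - x' - c n *\<^sub>R (A x - A xs)))\<^sup>2"
    using c[of n] by (intro add_nonneg_nonneg mult_nonneg_nonneg) simp_all
  also have "\<dots> \<le> (norm (xs - x))\<^sup>2 - (norm (xs - x'))\<^sup>2"
    unfolding x' by (rule forward_backward_Fejer[OF A B c(1) xs])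
  finally have "(norm (xs - x'))\<^sup>2 \<le> (norm (xs - x))\<^sup>2"
    by simp
  then show "norm (xs - x') \<le> norm (xs - x)"
    by (rule power2_le_imp_le) simp
qed

text \<open>
  The Fejer inequality forces \<open>A (z k) \<rightarrow> A xs\<close> strongly and cocoercivity identifies the limit
  as \<open>A zbar\<close>, so the maximality of \<open>B\<close> alone closes the graph at the weak limit.
\<close>

lemma forward_backward_P2:
  fixes A :: "'a::{real_inner, complete_space} \<Rightarrow> 'a"
  assumes A: "cocoercive \<alpha> A" and \<alpha>: "\<alpha> > 0" and B: "maximal_monotone B"
    and lo: "0 < c_min" "\<And>n. c_min \<le> c n" and hi: "\<And>n. c n \<le> c_max" "c_max < 2 * \<alpha>"
  shows "property_P2 (op_zeros (op_add (single_valued_op A) B))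
    (\<lambda>n. single_valued_op (forward_backward A B (c n)))"
  unfolding property_P2_def
proof (intro allI impI, elim conjE bexE)
  fix z zbar z' and n :: "nat \<Rightarrow> nat" and xs
  assume z: "weakly_converges z zbar"
    and "\<forall>k. z' k \<in> single_valued_op (forward_backward A B (c (n k))) (z k)"
    and "xs \<in> op_zeros (op_add (single_valued_op A) B)"
    and lim: "(\<lambda>k. norm (xs - z k) - norm (xs - z' k)) \<longlonglongrightarrow> 0"
  then have z': "z' k = forward_backward A B (c (n k)) (z k)" and xs: "- A xs \<in> B xs" for k
    unfolding op_zeros_iff by (simp_all add: single_valued_op_def)
  define g where "g k = A (z k) - A xs" for k
  define h where "h k = z k - z' k - c (n k) *\<^sub>R g k" for k
  define \<Delta> where "\<Delta> k = (norm (xs - z k))\<^sup>2 - (norm (xs - z' k))\<^sup>2" for k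
  \<comment> \<open>A lower bound for the weight \<open>c (n k) * (2 * \<alpha> - c (n k))\<close>,
    uniform in \<open>k\<close>.\<close>
  define \<kappa> where "\<kappa> = c_min * (2 * \<alpha> - c_max)"
  have \<kappa>: "\<kappa> > 0"
    using lo hi by (simp add: \<kappa>_def)
  have cpos: "c (n k) > 0" for k
    using lo by (rule less_le_trans)
  have Fejer: "\<kappa> * (norm (g k))\<^sup>2 + (norm (h k))\<^sup>2 \<le> \<Delta> k" for k
  proof -
    have "\<kappa> \<le> c (n k) * (2 * \<alpha> - c (n k))"
      unfolding \<kappa>_def using lo hi(1)[of "n k"] hi(2) cpos[of k] by (intro mult_mono) auto
    then have "\<kappa> * (norm (g k))\<^sup>2 \<le> c (n k) * (2 * \<alpha> - c (n k)) * (norm (g k))\<^sup>2"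
      by (rule mult_right_mono) simp
    then show ?thesis
      using forward_backward_Fejer[OF A B cpos xs, of k "z k"]
      unfolding g_def h_def \<Delta>_def z' by linarith
  qed
  \<comment> \<open>The difference of squares is a null sequence times a sum of norms. That sum is
    bounded: \<open>z\<close> converges weakly, and \<open>z' k\<close> is no farther from
    \<open>xs\<close> than \<open>z k\<close>.\<close>
  have \<Delta>_lim: "\<Delta> \<longlonglongrightarrow> 0"
  proof -
    have "Bseq (\<lambda>k. z k)"
      using weakly_converges_imp_Bseq[OF z] .
    then obtain K where K: "\<And>k. norm (z k) \<le> K"
      by (auto simp: Bseq_def)
    have "norm (norm (xs - z k) + norm (xs - z' k)) \<le> 2 * (norm xs + K)" for k
    proof -
      have "0 \<le> \<Delta> k"
        by (rule order_trans[OF _ Fejer]) (use \<kappa> in simp)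
      then have "(norm (xs - z' k))\<^sup>2 \<le> (norm (xs - z k))\<^sup>2"
        by (simp add: \<Delta>_def)
      then have "norm (xs - z' k) \<le> norm (xs - z k)"
        by (rule power2_le_imp_le) simp
      moreover have "norm (xs - z k) \<le> norm xs + K"
        using norm_triangle_ineq4[of xs "z k"] K[of k] by linarith
      ultimately show ?thesis
        by simp
    qed
    then have "Bfun (\<lambda>k. norm (xs - z k) + norm (xs - z' k)) sequentially"
      by (intro BseqI')
    with lim have "(\<lambda>k. (norm (xs - z k) - norm (xs - z' k)) *
        (norm (xs - z k) + norm (xs - z' k))) \<longlonglongrightarrow> 0"
      unfolding tendsto_Zfun_iff diff_zero
      by (rule bounded_bilinear.Zfun_prod_Bfun[OF bounded_bilinear_mult])
    then show ?thesis
      unfolding \<Delta>_def by (simp add: power2_eq_square algebra_simps)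
  qed
  have g_lim: "g \<longlonglongrightarrow> 0"
  proof -
    have "(norm (g k))\<^sup>2 \<le> \<Delta> k / \<kappa>" for k
    proof -
      have "\<kappa> * (norm (g k))\<^sup>2 \<le> \<Delta> k"
        by (rule order_trans[OF _ Fejer]) simp
      then show ?thesis
        using \<kappa> by (simp add: field_simps)
    qed
    then have "(\<lambda>k. (norm (g k))\<^sup>2) \<longlonglongrightarrow> 0"
      by (intro tendsto_sandwich[OF _ _ tendsto_const tendsto_divide_zero[OF \<Delta>_lim, of \<kappa>]])
        simp_all
    then show ?thesis
      by (simp add: tendsto_norm_zero_iff)
  qed
  have h_lim: "h \<longlonglongrightarrow> 0"
  proof -
    have "(norm (h k))\<^sup>2 \<le> \<Delta> k" for k
      by (rule order_trans[OF _ Fejer]) (use \<kappa> in simp)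
    then have "(\<lambda>k. (norm (h k))\<^sup>2) \<longlonglongrightarrow> 0"
      by (intro tendsto_sandwich[OF _ _ tendsto_const \<Delta>_lim]) simp_all
    then show ?thesis
      by (simp add: tendsto_norm_zero_iff)
  qed
  have "(\<lambda>k. c (n k) *\<^sub>R g k) \<longlonglongrightarrow> 0"
  proof (rule Lim_null_comparison)
    show "eventually (\<lambda>k. norm (c (n k) *\<^sub>R g k) \<le> c_max * norm (g k)) sequentially"
      using hi(1) cpos by (intro always_eventually allI) (simp add: less_imp_le mult_right_mono)
    show "(\<lambda>k. c_max * norm (g k)) \<longlonglongrightarrow> 0"
      using g_lim by (intro tendsto_mult_right_zero tendsto_norm_zero)
  qed
  from tendsto_add[OF h_lim this] have "(\<lambda>k. z k - z' k) \<longlonglongrightarrow> 0"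
    by (simp add: h_def)
  then have z'_weak: "weakly_converges z' zbar"
    by (rule weakly_converges_add_null[OF z])
  have Az_lim: "(\<lambda>k. A (z k)) \<longlonglongrightarrow> A xs"
    using g_lim unfolding g_def by (rule LIM_zero_cancel)
  \<comment> \<open>In the limit of cocoercivity between \<open>z k\<close> and \<open>zbar\<close>,
    the right side becomes a product with \<open>zbar - zbar\<close>, hence zero.\<close>
  have A_zbar: "A zbar = A xs"
  proof -
    have "(\<lambda>k. \<alpha> * (norm (A (z k) - A zbar))\<^sup>2) \<longlonglongrightarrow> \<alpha> * (norm (A xs - A zbar))\<^sup>2"
      by (intro tendsto_intros Az_lim)
    moreover have "(\<lambda>k. inner (z k - zbar) (A (z k) - A zbar))
        \<longlonglongrightarrow> inner (zbar - zbar) (A xs - A zbar)"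
      by (rule weakly_converges_inner[OF z Az_lim])
    ultimately have "\<alpha> * (norm (A xs - A zbar))\<^sup>2 \<le> inner (zbar - zbar) (A xs - A zbar)"
      by (rule LIMSEQ_le) (use A in \<open>simp add: cocoercive_def\<close>)
    then show ?thesis
      using \<alpha> by (simp add: mult_le_0_iff)
  qed
  define b where "b k = (z k - z' k) /\<^sub>R c (n k) - A (z k)" for k
  have b: "b k \<in> B (z' k)" for k
    unfolding b_def z' by (rule forward_backward_mem[OF B cpos])
  have "(\<lambda>k. h k /\<^sub>R c (n k)) \<longlonglongrightarrow> 0"
  proof (rule Lim_null_comparison)
    show "eventually (\<lambda>k. norm (h k /\<^sub>R c (n k)) \<le> norm (h k) / c_min) sequentially"
      using lo cpos by (intro always_eventually allI)
        (simp add: divide_inverse_commute le_imp_inverse_le less_imp_le mult_right_mono)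
    show "(\<lambda>k. norm (h k) / c_min) \<longlonglongrightarrow> 0"
      using h_lim by (intro tendsto_divide_zero tendsto_norm_zero)
  qed
  \<comment> \<open>The forward term in \<open>h\<close> turns \<open>A (z k)\<close> into
    \<open>A xs\<close>, so \<open>b\<close> converges strongly once \<open>h k\<close> over the
    step size vanishes.\<close>
  moreover have "h k /\<^sub>R c (n k) - A xs = b k" for k
    using cpos[of k] by (simp add: h_def b_def g_def scaleR_diff_right)
  ultimately have b_lim: "b \<longlonglongrightarrow> - A xs"
    using tendsto_diff[OF _ tendsto_const, of "\<lambda>k. h k /\<^sub>R c (n k)" 0 sequentially "A xs"] by simp
  \<comment> \<open>Monotonicity at the graph points \<open>(z' k, b k)\<close> survives the limit,
    weak in the first entry and strong in the second.\<close>
  have "inner (zbar - y) (- A xs - v) \<ge> 0" if "v \<in> B y" for y v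
    by (rule LIMSEQ_le_const[OF weakly_converges_inner[OF z'_weak b_lim]])
      (use maximal_monotoneD[OF B b that] in blast)
  then have "- A zbar \<in> B zbar"
    using B unfolding A_zbar maximal_monotone_iff by blast
  then show "zbar \<in> op_zeros (op_add (single_valued_op A) B)"
    by (simp add: op_zeros_iff)
qed

theorem corollary5p2:
  fixes A :: "'a::{real_inner, complete_space} \<Rightarrow> 'a"
    and B :: "'a \<Rightarrow> 'a set"
    and \<alpha> lam_min lam_max \<sigma> :: real
    and lam :: "nat \<Rightarrow> real"
    and x :: "nat \<Rightarrow> 'a"
  assumes "\<alpha> > 0"
    and "cocoercive \<alpha> A"
    and "maximal_monotone B"
    and "0 < lam_min" and "lam_min \<le> lam_max" and "lam_max < 2 * \<alpha>"
    and "\<forall>k\<ge>1. lam k \<in> {lam_min..lam_max}"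
    and "\<forall>k\<ge>1. x k = resolvent (op_scale (lam k) B) (x (k - 1) - lam k *\<^sub>R A (x (k - 1)))"
    and "\<sigma> = sqrt (lam_max / (2 * \<alpha>))"
  shows "0 < \<sigma> \<and> \<sigma> < 1 \<and>
    (\<forall>y. \<forall>k\<ge>1. forward_backward A B (lam k) y
        \<in> approx_resolvent (op_scale (lam k) (op_add (single_valued_op A) B)) \<sigma> y) \<and>
    (\<forall>k\<ge>1. x k = forward_backward A B (lam k) (x (k - 1)) \<and>
        x k \<in> approx_resolvent (op_scale (lam k) (op_add (single_valued_op A) B)) \<sigma> (x (k - 1))) \<and>
    property_P1 (op_zeros (op_add (single_valued_op A) B))
      (\<lambda>n. single_valued_op (forward_backward A B (lam (Suc n)))) \<and>
    property_P2 (op_zeros (op_add (single_valued_op A) B))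
      (\<lambda>n. single_valued_op (forward_backward A B (lam (Suc n))))"
proof -
  have lam: "lam_min \<le> lam k" "lam k \<le> lam_max" "0 < lam k" if "k \<ge> 1" for k
    using assms(4,7) that by force+
  have \<sigma>: "0 < \<sigma>" "\<sigma> < 1" and \<sigma>_sq: "\<sigma>\<^sup>2 = lam_max / (2 * \<alpha>)"
    using assms(1,4,5,6,9) by simp_all
  have approx: "forward_backward A B (lam k) y
      \<in> approx_resolvent (op_scale (lam k) (op_add (single_valued_op A) B)) \<sigma> y" if "k \<ge> 1" for k y
  proof (rule forward_backward_approx_resolvent[OF assms(2,1,3) lam(3)[OF that]])
    show "lam k / (2 * \<alpha>) \<le> \<sigma>\<^sup>2"
      using lam(2)[OF that] assms(1) by (simp add: \<sigma>_sq divide_right_mono)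
  qed
  have step: "x k = forward_backward A B (lam k) (x (k - 1))" if "k \<ge> 1" for k
    using assms(8) that by (simp add: forward_backward_def)
  have step_mem: "x k \<in>
      approx_resolvent (op_scale (lam k) (op_add (single_valued_op A) B)) \<sigma> (x (k - 1))"
    if "k \<ge> 1" for k
    by (subst step[OF that]) (rule approx[OF that])
  \<comment> \<open>Families of maps are indexed from 0 but step sizes are constrained from 1 on,
    hence the shift by \<open>Suc\<close>.\<close>
  have "property_P1 (op_zeros (op_add (single_valued_op A) B))
      (\<lambda>n. single_valued_op (forward_backward A B (lam (Suc n))))"
  proof (rule forward_backward_P1[OF assms(2,3)])
    show "0 < lam (Suc n)" "lam (Suc n) \<le> 2 * \<alpha>" for n
      using lam(2,3)[of "Suc n"] assms(6) by auto
  qed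
  moreover have "property_P2 (op_zeros (op_add (single_valued_op A) B))
      (\<lambda>n. single_valued_op (forward_backward A B (lam (Suc n))))"
    using lam(1,2) by (intro forward_backward_P2[OF assms(2,1,3,4) _ _ assms(6)]) auto
  ultimately show ?thesis
    using \<sigma> approx step step_mem by blast
qed

end
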